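(* Let $R$ be a $G$-graded ring and let $M$ be a $G$-graded weakly topological $R$-module. If $R$ is a Noetherian graded ring and for every graded submodule $P$ of $M$ there exists a graded ideal $I$ of $R$ such that $\chi(P)=\chi(IM)$, then $\Upsilon_M$ (with the Zariski topology) is a graded weakly spectral space.
   Context: Conventions: $G$ is an abelian group with identity $e$; rings are commutative with identity and modules are unital. A ring $R$ is $G$-graded if $R=\bigoplus_{g\in G}R_g$ with additive subgroups $R_g$ and $R_gR_h\subseteq R_{gh}$; $h(R)=\bigcup_{g}R_g$. An ideal $I$ of $R$ is graded if $I=\bigoplus_g (I\cap R_g)$. An $R$-module $M$ is $G$-graded if $M=\bigoplus_{g}M_g$ with additive subgroups $M_g$ and $R_gM_h\subseteq M_{gh}$. A submodule $P$ of $M$ is graded if $P=\bigoplus_g (P\cap M_g)$. Put $(P:_RM)=\{r\in R: rM\subseteq P\}$. A proper graded ideal $I$ of $R$ is graded weakly prime if whenever $a,b\in h(R)$ and $0\neq ab\in I$, then $a\in I$ or $b\in I$. A graded submodule $P$ of $M$ is graded pseudo weakly prime if $(P:_RM)$ is a graded weakly prime ideal of $R$; $\Upsilon_M$ is the set of all graded pseudo weakly prime submodules of $M$. A graded submodule of $M$ is graded pseudo weakly semiprime if it is an intersection of graded pseudo weakly prime submodules of $M$. A graded pseudo weakly prime submodule $P$ of $M$ is graded weakly extraordinary if whenever $I,J$ are graded pseudo weakly semiprime submodules of $M$ with $\{0\}\neq I\cap J\subseteq P$, then $I\subseteq P$ or $J\subseteq P$. $M$ is $G$-graded weakly topological if $\Upsilon_M=\emptyset$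 or every graded pseudo weakly prime submodule of $M$ is graded weakly extraordinary. For a graded submodule $N$ of $M$, $\chi(N)=\{I\in\Upsilon_M: N\subseteq I\}$. The Zariski topology on $\Upsilon_M$ is the topology whose closed sets are exactly the sets $\chi(N)$, $N$ a graded submodule of $M$. A topological space $T$ is a graded weakly spectral space if: (1) $T$ is a $T_0$-space; (2) $T$ is quasi-compact; (3) the quasi-compact open subsets of $T$ are closed under finite intersection; (4) every irreducible closed subset of $T$ has a generic point (a point $x$ of the subset whose closure is the whole subset; irreducible sets are nonempty by convention).
   Formalization: The sets χ(N) need not be closed under finite unions (e.g. R = M = ℤ/6, trivially graded), so the Zariski topology is taken as the coarsest topology in which all χ(N) are closed; it is the stated topology whenever that one exists. *)

theory Defs
  imports
    "HOL-Algebra.Module"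
    "HOL-Algebra.Ring_Divisibility"
    "HOL-Algebra.Generated_Groups"
    "HOL-Analysis.Abstract_Topological_Spaces"
begin

section \<open>Gradings\<close>

text \<open>Only the additive structure of \<open>A\<close> is used. The index function of a decomposition is
  extensional outside \<open>K\<close>, so that uniqueness of the homogeneous components makes sense. The
  definition is applied to rings, ideals, modules and submodules alike.\<close>

definition internal_direct_sum ::
    "('a, 'c) ring_scheme \<Rightarrow> 'i set \<Rightarrow> ('i \<Rightarrow> 'a set) \<Rightarrow> 'a set \<Rightarrow> bool" where
  "internal_direct_sum A K S X \<longleftrightarrow>
     additive_subgroup X A \<and>
     (\<forall>i\<in>K. additive_subgroup (S i) A \<and> S i \<subseteq> X) \<and>
     (\<forall>x\<in>X. \<exists>!f. f \<in> (\<Pi>\<^sub>E i\<in>K. S i) \<and> finite {i \<in> K. f i \<noteq> \<zero>\<^bsub>A\<^esub>} \<and>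
        x = finsum A f {i \<in> K. f i \<noteq> \<zero>\<^bsub>A\<^esub>})"

definition graded_ring ::
    "('g, 'k) monoid_scheme \<Rightarrow> ('a, 'c) ring_scheme \<Rightarrow> ('g \<Rightarrow> 'a set) \<Rightarrow> bool" where
  "graded_ring G R gr \<longleftrightarrow>
     comm_group G \<and> cring R \<and> internal_direct_sum R (carrier G) gr (carrier R) \<and>
     (\<forall>g\<in>carrier G. \<forall>h\<in>carrier G. \<forall>a\<in>gr g. \<forall>b\<in>gr h. a \<otimes>\<^bsub>R\<^esub> b \<in> gr (g \<otimes>\<^bsub>G\<^esub> h))"

definition graded_module ::
    "('g, 'k) monoid_scheme \<Rightarrow> ('a, 'c) ring_scheme \<Rightarrow> ('g \<Rightarrow> 'a set) \<Rightarrow>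
     ('a, 'b, 'd) module_scheme \<Rightarrow> ('g \<Rightarrow> 'b set) \<Rightarrow> bool" where
  "graded_module G R gr M gm \<longleftrightarrow>
     graded_ring G R gr \<and> Module.module R M \<and>
     internal_direct_sum M (carrier G) gm (carrier M) \<and>
     (\<forall>g\<in>carrier G. \<forall>h\<in>carrier G. \<forall>a\<in>gr g. \<forall>x\<in>gm h. a \<odot>\<^bsub>M\<^esub> x \<in> gm (g \<otimes>\<^bsub>G\<^esub> h))"

definition homogeneous :: "('g, 'k) monoid_scheme \<Rightarrow> ('g \<Rightarrow> 'a set) \<Rightarrow> 'a set" where
  "homogeneous G gr = (\<Union>g\<in>carrier G. gr g)"

definition graded_ideal ::
    "('g, 'k) monoid_scheme \<Rightarrow> ('a, 'c) ring_scheme \<Rightarrow> ('g \<Rightarrow> 'a set) \<Rightarrow> 'a set \<Rightarrow> bool" where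
  "graded_ideal G R gr I \<longleftrightarrow>
     ideal I R \<and> internal_direct_sum R (carrier G) (\<lambda>g. I \<inter> gr g) I"

definition graded_submodule ::
    "('g, 'k) monoid_scheme \<Rightarrow> ('a, 'c) ring_scheme \<Rightarrow>
     ('a, 'b, 'd) module_scheme \<Rightarrow> ('g \<Rightarrow> 'b set) \<Rightarrow> 'b set \<Rightarrow> bool" where
  "graded_submodule G R M gm P \<longleftrightarrow>
     submodule P R M \<and> internal_direct_sum M (carrier G) (\<lambda>g. P \<inter> gm g) P"

definition residual ::
    "('a, 'c) ring_scheme \<Rightarrow> ('a, 'b, 'd) module_scheme \<Rightarrow> 'b set \<Rightarrow> 'a set" where
  "residual R M P = {r \<in> carrier R. \<forall>m\<in>carrier M. r \<odot>\<^bsub>M\<^esub> m \<in> P}"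

text \<open>\<open>IM\<close>: all finite sums of products \<open>a m\<close> with \<open>a \<in> I\<close> and \<open>m \<in> M\<close>.\<close>

definition ideal_smult :: "'a set \<Rightarrow> ('a, 'b, 'd) module_scheme \<Rightarrow> 'b set" where
  "ideal_smult I M = generate (add_monoid M) {a \<odot>\<^bsub>M\<^esub> m | a m. a \<in> I \<and> m \<in> carrier M}"


section \<open>Graded pseudo weakly prime submodules\<close>

definition graded_weakly_prime ::
    "('g, 'k) monoid_scheme \<Rightarrow> ('a, 'c) ring_scheme \<Rightarrow> ('g \<Rightarrow> 'a set) \<Rightarrow> 'a set \<Rightarrow> bool" where
  "graded_weakly_prime G R gr I \<longleftrightarrow>
     graded_ideal G R gr I \<and> I \<noteq> carrier R \<and>
     (\<forall>a\<in>homogeneous G gr. \<forall>b\<in>homogeneous G gr.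
        a \<otimes>\<^bsub>R\<^esub> b \<noteq> \<zero>\<^bsub>R\<^esub> \<and> a \<otimes>\<^bsub>R\<^esub> b \<in> I \<longrightarrow> a \<in> I \<or> b \<in> I)"

definition pseudo_weakly_spectrum ::
    "('g, 'k) monoid_scheme \<Rightarrow> ('a, 'c) ring_scheme \<Rightarrow> ('g \<Rightarrow> 'a set) \<Rightarrow>
     ('a, 'b, 'd) module_scheme \<Rightarrow> ('g \<Rightarrow> 'b set) \<Rightarrow> 'b set set" where
  "pseudo_weakly_spectrum G R gr M gm =
     {P. graded_submodule G R M gm P \<and> graded_weakly_prime G R gr (residual R M P)}"

text \<open>The empty intersection \<open>M\<close> is not admitted here. This is immaterial for
  \<open>graded_weakly_extraordinary\<close>, whose condition holds trivially if \<open>I\<close> or \<open>J\<close> is \<open>M\<close>.\<close>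

definition graded_pseudo_weakly_semiprime ::
    "('g, 'k) monoid_scheme \<Rightarrow> ('a, 'c) ring_scheme \<Rightarrow> ('g \<Rightarrow> 'a set) \<Rightarrow>
     ('a, 'b, 'd) module_scheme \<Rightarrow> ('g \<Rightarrow> 'b set) \<Rightarrow> 'b set \<Rightarrow> bool" where
  "graded_pseudo_weakly_semiprime G R gr M gm P \<longleftrightarrow>
     graded_submodule G R M gm P \<and>
     (\<exists>\<S>. \<S> \<noteq> {} \<and> \<S> \<subseteq> pseudo_weakly_spectrum G R gr M gm \<and> P = \<Inter>\<S>)"

definition graded_weakly_extraordinary ::
    "('g, 'k) monoid_scheme \<Rightarrow> ('a, 'c) ring_scheme \<Rightarrow> ('g \<Rightarrow> 'a set) \<Rightarrow>
     ('a, 'b, 'd) module_scheme \<Rightarrow> ('g \<Rightarrow> 'b set) \<Rightarrow> 'b set \<Rightarrow> bool" where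
  "graded_weakly_extraordinary G R gr M gm P \<longleftrightarrow>
     P \<in> pseudo_weakly_spectrum G R gr M gm \<and>
     (\<forall>I J. graded_pseudo_weakly_semiprime G R gr M gm I \<and>
            graded_pseudo_weakly_semiprime G R gr M gm J \<and>
            I \<inter> J \<noteq> {\<zero>\<^bsub>M\<^esub>} \<and> I \<inter> J \<subseteq> P \<longrightarrow> I \<subseteq> P \<or> J \<subseteq> P)"

definition graded_weakly_topological ::
    "('g, 'k) monoid_scheme \<Rightarrow> ('a, 'c) ring_scheme \<Rightarrow> ('g \<Rightarrow> 'a set) \<Rightarrow>
     ('a, 'b, 'd) module_scheme \<Rightarrow> ('g \<Rightarrow> 'b set) \<Rightarrow> bool" where
  "graded_weakly_topological G R gr M gm \<longleftrightarrow>
     pseudo_weakly_spectrum G R gr M gm = {} \<or>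
     (\<forall>P\<in>pseudo_weakly_spectrum G R gr M gm. graded_weakly_extraordinary G R gr M gm P)"


section \<open>The Zariski topology\<close>

definition zariski_closed ::
    "('g, 'k) monoid_scheme \<Rightarrow> ('a, 'c) ring_scheme \<Rightarrow> ('g \<Rightarrow> 'a set) \<Rightarrow>
     ('a, 'b, 'd) module_scheme \<Rightarrow> ('g \<Rightarrow> 'b set) \<Rightarrow> 'b set \<Rightarrow> 'b set set" where
  "zariski_closed G R gr M gm N = {P \<in> pseudo_weakly_spectrum G R gr M gm. N \<subseteq> P}"

text \<open>The sets \<open>\<chi>(N)\<close> need not be closed under binary unions, even if \<open>M\<close> is graded weakly
  topological and \<open>R\<close> is Noetherian. Take \<open>R = M = \<int>/6\<close>, trivially graded: the spectrum is
  \<open>{0, (2), (3)}\<close>, and \<open>{(2)}\<close> and \<open>{(3)}\<close> are of the form \<open>\<chi>(N)\<close> but \<open>{(2), (3)}\<close> is not. The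
  topology is therefore defined as the coarsest one in which all \<open>\<chi>(N)\<close> are closed. By
  \<open>zariski_topology_unique\<close> below, it is the topology whose closed sets are exactly the \<open>\<chi>(N)\<close>
  whenever such a topology exists.\<close>

definition zariski_topology ::
    "('g, 'k) monoid_scheme \<Rightarrow> ('a, 'c) ring_scheme \<Rightarrow> ('g \<Rightarrow> 'a set) \<Rightarrow>
     ('a, 'b, 'd) module_scheme \<Rightarrow> ('g \<Rightarrow> 'b set) \<Rightarrow> 'b set topology" where
  "zariski_topology G R gr M gm =
     topology_generated_by
       {pseudo_weakly_spectrum G R gr M gm - zariski_closed G R gr M gm N | N.
          graded_submodule G R M gm N}"

lemma zariski_topology_unique:
  assumes space: "topspace T = pseudo_weakly_spectrum G R gr M gm"
    and closed: "\<And>C. closedin T C \<longleftrightarrow>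
      (\<exists>N. graded_submodule G R M gm N \<and> C = zariski_closed G R gr M gm N)"
  shows "zariski_topology G R gr M gm = T"
proof -
  let ?U = "pseudo_weakly_spectrum G R gr M gm"
  let ?B = "{?U - zariski_closed G R gr M gm N | N. graded_submodule G R M gm N}"
  have B: "openin T V \<longleftrightarrow> V \<in> ?B" for V
  proof
    assume V: "openin T V"
    then have "closedin T (?U - V)"
      by (metis space closedin_diff closedin_topspace)
    then obtain N where "graded_submodule G R M gm N" "?U - V = zariski_closed G R gr M gm N"
      using closed by blast
    moreover have "V = ?U - (?U - V)"
      using openin_subset[OF V] space by auto
    ultimately show "V \<in> ?B" by auto
  next
    assume "V \<in> ?B"
    then obtain N where N: "graded_submodule G R M gm N" "V = ?U - zariski_closed G R gr M gm N"
      by blast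
    then have "closedin T (zariski_closed G R gr M gm N)"
      using closed by blast
    then show "openin T V"
      using N space by (metis openin_diff openin_topspace)
  qed
  have "generate_topology_on ?B V \<longleftrightarrow> openin T V" for V
  proof
    assume "generate_topology_on ?B V"
    then show "openin T V"
      by (rule generate_topology_on_coarsest[OF istopology_openin, rotated]) (use B in blast)
  next
    assume "openin T V"
    then show "generate_topology_on ?B V"
      using B generate_topology_on.Basis by blast
  qed
  then show ?thesis
    unfolding zariski_topology_def by (simp add: topology_eq openin_topology_generated_by_iff)
qed


section \<open>Graded weakly spectral spaces\<close>

definition irreducible_subset :: "'x topology \<Rightarrow> 'x set \<Rightarrow> bool" where
  "irreducible_subset T Y \<longleftrightarrow>
     Y \<subseteq> topspace T \<and> Y \<noteq> {} \<and>
     (\<forall>A B. closedin T A \<and> closedin T B \<and> Y \<subseteq> A \<union> B \<longrightarrow> Y \<subseteq> A \<or> Y \<subseteq> B)"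

definition graded_weakly_spectral_space :: "'x topology \<Rightarrow> bool" where
  "graded_weakly_spectral_space T \<longleftrightarrow>
     t0_space T \<and>
     compact_space T \<and>
     (\<forall>U V. openin T U \<and> compactin T U \<and> openin T V \<and> compactin T V \<longrightarrow> compactin T (U \<inter> V)) \<and>
     (\<forall>Y. closedin T Y \<and> irreducible_subset T Y \<longrightarrow> (\<exists>x\<in>Y. T closure_of {x} = Y))"

end

theory Submission
  imports Defs
begin

text \<open>The closed sets \<open>\<chi>(N)\<close> form a subbasis of closed sets, and by hypothesis each of them has the
  form \<open>V(I) = {P. I \<subseteq> (P : M)}\<close> for an ideal \<open>I\<close> of the Noetherian ring \<open>R\<close>.

  Compactness: every subset \<open>S\<close> of the spectrum is compact. By Noetherian induction on \<open>I\<close>, each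
  \<open>S \<inter> V(I)\<close> is compact. Given an open cover of it, choose one member \<open>W\<close> of the cover and a point
  of \<open>S \<inter> V(I)\<close> in \<open>W\<close>; a basic neighbourhood of that point inside \<open>W\<close> has a complement which is a
  finite union of sets \<open>V(J)\<close>, and \<open>V(I) \<inter> V(J)\<close> is \<open>V\<close> of a strictly larger ideal. This is
  \<open>compactin_subbase_of_ideals\<close>, and it gives both quasi-compactness and the condition on
  intersections.

  Generic points: closures of points are computed by inclusion of submodules, so for an irreducible
  closed set \<open>Y\<close> the only candidate is \<open>Q = \<Inter>Y\<close>. Its residual is the intersection of the graded
  weakly prime ideals \<open>(P : M)\<close> with \<open>P \<in> Y\<close>. If \<open>0 \<noteq> ab \<in> (Q : M)\<close> with \<open>a\<close> and \<open>b\<close> homogeneous,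
  then \<open>Y \<subseteq> \<chi>(aM) \<union> \<chi>(bM)\<close>, where \<open>aM\<close> and \<open>bM\<close> are graded submodules, and irreducibility
  yields \<open>a \<in> (Q : M)\<close> or \<open>b \<in> (Q : M)\<close>; hence \<open>Q\<close> is a point of the spectrum. An irreducible
  closed set is an intersection of sets \<open>\<chi>(N)\<close>, each of which then contains \<open>Q\<close>, so \<open>Q \<in> Y\<close>.\<close>


section \<open>Homogeneous components\<close>

text \<open>\<open>f\<close> is the family of homogeneous components of \<open>x\<close>, in the encoding used by
  \<open>internal_direct_sum\<close>: extensional outside \<open>K\<close>, with finite support in \<open>K\<close>.\<close>

definition components_of ::
    "('a, 'c) ring_scheme \<Rightarrow> 'i set \<Rightarrow> ('i \<Rightarrow> 'a set) \<Rightarrow> ('i \<Rightarrow> 'a) \<Rightarrow> 'a \<Rightarrow> bool" where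
  "components_of A K S f x \<longleftrightarrow>
     f \<in> (\<Pi>\<^sub>E i\<in>K. S i) \<and> finite {i \<in> K. f i \<noteq> \<zero>\<^bsub>A\<^esub>} \<and>
     x = finsum A f {i \<in> K. f i \<noteq> \<zero>\<^bsub>A\<^esub>}"

lemma internal_direct_sum_components_of:
  "internal_direct_sum A K S X \<longleftrightarrow>
     additive_subgroup X A \<and> (\<forall>i\<in>K. additive_subgroup (S i) A \<and> S i \<subseteq> X) \<and>
     (\<forall>x\<in>X. \<exists>!f. components_of A K S f x)"
  unfolding internal_direct_sum_def components_of_def by simp

lemma components_of_mono:
  assumes "components_of A K S f x" and "\<And>i. i \<in> K \<Longrightarrow> S i \<subseteq> S' i"
  shows "components_of A K S' f x"
  using assms PiE_mono[of K S S'] unfolding components_of_def by blast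

lemma additive_subgroup_Inter:
  assumes A: "abelian_group A" and "\<X> \<noteq> {}"
    and sub: "\<And>X. X \<in> \<X> \<Longrightarrow> additive_subgroup X A"
  shows "additive_subgroup (\<Inter>\<X>) A"
proof -
  interpret abelian_group A by fact
  show ?thesis
    using add.subgroups_Inter[of \<X>] \<open>\<X> \<noteq> {}\<close> sub by (auto simp: additive_subgroup_def)
qed

lemma internal_direct_sum_subgroupI:
  assumes A: "abelian_group A" and S: "internal_direct_sum A K S (carrier A)"
    and X: "additive_subgroup X A"
    and ex: "\<And>x. x \<in> X \<Longrightarrow> \<exists>f. components_of A K (\<lambda>i. X \<inter> S i) f x"
  shows "internal_direct_sum A K (\<lambda>i. X \<inter> S i) X"
proof -
  have XA: "X \<subseteq> carrier A"
    by (rule additive_subgroup.a_subset[OF X])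
  have "additive_subgroup (X \<inter> S i) A" if "i \<in> K" for i
    using additive_subgroup_Inter[OF A, of "{X, S i}"] X S that
    by (auto simp: internal_direct_sum_components_of)
  moreover have "\<exists>!f. components_of A K (\<lambda>i. X \<inter> S i) f x" if "x \<in> X" for x
  proof -
    have "\<exists>!f. components_of A K S f x"
      using S subsetD[OF XA that] by (simp add: internal_direct_sum_components_of)
    moreover have "components_of A K S f x" if "components_of A K (\<lambda>i. X \<inter> S i) f x" for f
      by (rule components_of_mono[OF that]) simp
    ultimately show ?thesis
      using ex[OF that] by blast
  qed
  ultimately show ?thesis
    using X by (simp add: internal_direct_sum_components_of)
qed

text \<open>A nonempty intersection of graded subgroups is graded: uniqueness of components in the whole
  group makes the components taken in the individual subgroups agree.\<close>

lemma internal_direct_sum_Inter: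
  assumes A: "abelian_group A" and S: "internal_direct_sum A K S (carrier A)"
    and ne: "\<X> \<noteq> {}"
    and X: "\<And>X. X \<in> \<X> \<Longrightarrow> internal_direct_sum A K (\<lambda>i. X \<inter> S i) X"
  shows "internal_direct_sum A K (\<lambda>i. \<Inter>\<X> \<inter> S i) (\<Inter>\<X>)"
proof (rule internal_direct_sum_subgroupI[OF A S])
  show sub: "additive_subgroup (\<Inter>\<X>) A"
    using additive_subgroup_Inter[OF A ne] X by (simp add: internal_direct_sum_components_of)
  fix x assume x: "x \<in> \<Inter>\<X>"
  then have "x \<in> carrier A"
    using additive_subgroup.a_subset[OF sub] by blast
  then have "\<exists>!f. components_of A K S f x"
    using S by (simp add: internal_direct_sum_components_of)
  then obtain f where f: "components_of A K S f x"
      and uniq: "\<And>f'. components_of A K S f' x \<Longrightarrow> f' = f"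
    by metis
  have fX: "components_of A K (\<lambda>i. X \<inter> S i) f x" if X': "X \<in> \<X>" for X
  proof -
    have "x \<in> X" using x X' by blast
    then obtain f' where f': "components_of A K (\<lambda>i. X \<inter> S i) f' x"
      using X[OF X'] unfolding internal_direct_sum_components_of by metis
    then have "components_of A K S f' x"
      by (rule components_of_mono) simp
    with f' uniq show ?thesis by blast
  qed
  then have "f i \<in> X" if "X \<in> \<X>" "i \<in> K" for X i
    using that by (auto simp: components_of_def PiE_iff)
  then have "components_of A K (\<lambda>i. \<Inter>\<X> \<inter> S i) f x"
    using f by (auto simp: components_of_def PiE_iff)
  then show "\<exists>f. components_of A K (\<lambda>i. \<Inter>\<X> \<inter> S i) f x"
    by blast
qed


section \<open>Graded submodules\<close>

lemma submodule_additive_subgroup: "submodule P R M \<Longrightarrow> additive_subgroup P M"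
  by (simp add: additive_subgroupI submodule.axioms(1))

lemma submodule_Inter:
  assumes M: "module R M" and ne: "\<X> \<noteq> {}" and X: "\<And>X. X \<in> \<X> \<Longrightarrow> submodule X R M"
  shows "submodule (\<Inter>\<X>) R M"
proof -
  interpret module R M by fact
  have "additive_subgroup (\<Inter>\<X>) M"
    using additive_subgroup_Inter[OF M.abelian_group_axioms ne] X submodule_additive_subgroup by blast
  then show ?thesis
    using submodule.smult_closed[OF X]
    by (auto simp: submodule_def submodule_axioms_def additive_subgroup_def)
qed

lemma graded_submodule_Inter:
  assumes M: "graded_module G R gr M gm" and ne: "\<X> \<noteq> {}"
    and X: "\<And>X. X \<in> \<X> \<Longrightarrow> graded_submodule G R M gm X"
  shows "graded_submodule G R M gm (\<Inter>\<X>)"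
  using assms submodule_Inter[of R M \<X>] internal_direct_sum_Inter[of M "carrier G" gm \<X>]
  by (auto simp: graded_submodule_def graded_module_def module_def)

lemma graded_ideal_Inter:
  assumes R: "graded_ring G R gr" and ne: "\<I> \<noteq> {}"
    and I: "\<And>I. I \<in> \<I> \<Longrightarrow> graded_ideal G R gr I"
  shows "graded_ideal G R gr (\<Inter>\<I>)"
proof -
  interpret cring R using R by (simp add: graded_ring_def)
  show ?thesis
    using R I ne i_Intersect[of \<I>]
      internal_direct_sum_Inter[OF abelian_group_axioms, of "carrier G" gr \<I>]
    by (auto simp: graded_ideal_def graded_ring_def)
qed

lemma submodule_smult_image:
  assumes M: "module R M" and a: "a \<in> carrier R"
  shows "submodule ((\<odot>\<^bsub>M\<^esub>) a ` carrier M) R M"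
proof -
  interpret module R M by fact
  show ?thesis
  proof (rule submoduleI)
    show "\<zero>\<^bsub>M\<^esub> \<in> (\<odot>\<^bsub>M\<^esub>) a ` carrier M"
      using a by (metis M.zero_closed imageI smult_r_null)
  next
    fix x assume "x \<in> (\<odot>\<^bsub>M\<^esub>) a ` carrier M"
    then show "\<ominus>\<^bsub>M\<^esub> x \<in> (\<odot>\<^bsub>M\<^esub>) a ` carrier M"
      using a by (auto simp flip: smult_r_minus)
  next
    fix x y assume "x \<in> (\<odot>\<^bsub>M\<^esub>) a ` carrier M" "y \<in> (\<odot>\<^bsub>M\<^esub>) a ` carrier M"
    then show "x \<oplus>\<^bsub>M\<^esub> y \<in> (\<odot>\<^bsub>M\<^esub>) a ` carrier M"
      using a by (auto simp flip: smult_r_distr)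
  next
    fix b x assume b: "b \<in> carrier R" and "x \<in> (\<odot>\<^bsub>M\<^esub>) a ` carrier M"
    then obtain m where m: "m \<in> carrier M" "x = a \<odot>\<^bsub>M\<^esub> m" by blast
    then have "b \<odot>\<^bsub>M\<^esub> x = a \<odot>\<^bsub>M\<^esub> (b \<odot>\<^bsub>M\<^esub> m)"
      using a b by (metis R.m_comm smult_assoc1)
    then show "b \<odot>\<^bsub>M\<^esub> x \<in> (\<odot>\<^bsub>M\<^esub>) a ` carrier M"
      using b m by auto
  qed (use a in auto)
qed

text \<open>For \<open>a\<close> of degree \<open>g\<close>, the component of degree \<open>j\<close> of \<open>a m\<close> is \<open>a\<close> times the component of
  degree \<open>g\<^sup>-\<^sup>1 j\<close> of \<open>m\<close>.\<close>

lemma graded_submodule_smult_image: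
  assumes M: "graded_module G R gr M gm" and a: "a \<in> homogeneous G gr"
  shows "graded_submodule G R M gm ((\<odot>\<^bsub>M\<^esub>) a ` carrier M)"
proof -
  interpret module R M
    using M by (simp add: graded_module_def)
  interpret G: comm_group G
    using M by (simp add: graded_module_def graded_ring_def)
  have gm: "internal_direct_sum M (carrier G) gm (carrier M)"
    using M by (simp add: graded_module_def)
  obtain g where g: "g \<in> carrier G" "a \<in> gr g"
    using a by (auto simp: homogeneous_def)
  have aR: "a \<in> carrier R"
    using M g by (auto simp: graded_module_def graded_ring_def internal_direct_sum_def)
  have sub: "submodule ((\<odot>\<^bsub>M\<^esub>) a ` carrier M) R M"
    using module_axioms aR by (rule submodule_smult_image)
  have "internal_direct_sum M (carrier G)
      (\<lambda>i. (\<odot>\<^bsub>M\<^esub>) a ` carrier M \<inter> gm i) ((\<odot>\<^bsub>M\<^esub>) a ` carrier M)"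
  proof (rule internal_direct_sum_subgroupI[OF M.abelian_group_axioms gm])
    show "additive_subgroup ((\<odot>\<^bsub>M\<^esub>) a ` carrier M) M"
      using sub by (rule submodule_additive_subgroup)
    fix x assume "x \<in> (\<odot>\<^bsub>M\<^esub>) a ` carrier M"
    then obtain m where m: "m \<in> carrier M" "x = a \<odot>\<^bsub>M\<^esub> m" by blast
    then obtain f where f: "components_of M (carrier G) gm f m"
      using gm by (auto simp: internal_direct_sum_components_of)
    define F where "F = {i \<in> carrier G. f i \<noteq> \<zero>\<^bsub>M\<^esub>}"
    have F: "finite F" "F \<subseteq> carrier G" "m = finsum M f F"
      using f by (auto simp: components_of_def F_def)
    have gm_sub: "gm i \<subseteq> carrier M" if "i \<in> carrier G" for i
      using gm that by (auto simp: internal_direct_sum_def)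
    have f_gm: "f i \<in> gm i" if "i \<in> carrier G" for i
      using f that by (auto simp: components_of_def PiE_iff)
    have f_M: "f i \<in> carrier M" if "i \<in> carrier G" for i
      using f_gm gm_sub that by blast
    \<comment> \<open>The support of \<open>f'\<close> may be smaller than the shifted support \<open>F'\<close>, since \<open>a\<close> may annihilate
        some components of \<open>m\<close>.\<close>
    define f' where
      "f' = (\<lambda>j\<in>carrier G. a \<odot>\<^bsub>M\<^esub> f (inv\<^bsub>G\<^esub> g \<otimes>\<^bsub>G\<^esub> j))"
    define F' where "F' = (\<otimes>\<^bsub>G\<^esub>) g ` F"
    have f'_in: "f' j \<in> (\<odot>\<^bsub>M\<^esub>) a ` carrier M \<inter> gm j" if j: "j \<in> carrier G" for j
    proof -
      have "a \<odot>\<^bsub>M\<^esub> f (inv\<^bsub>G\<^esub> g \<otimes>\<^bsub>G\<^esub> j) \<in> gm (g \<otimes>\<^bsub>G\<^esub> (inv\<^bsub>G\<^esub> g \<otimes>\<^bsub>G\<^esub> j))"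
        using M g j f_gm by (auto simp: graded_module_def)
      also have "g \<otimes>\<^bsub>G\<^esub> (inv\<^bsub>G\<^esub> g \<otimes>\<^bsub>G\<^esub> j) = j"
        using g j by (simp add: G.m_assoc[symmetric])
      finally show ?thesis
        using g j f_M by (auto simp: f'_def)
    qed
    have f'_shift: "f' (g \<otimes>\<^bsub>G\<^esub> i) = a \<odot>\<^bsub>M\<^esub> f i" if "i \<in> carrier G" for i
      using g that by (simp add: f'_def G.m_assoc[symmetric])
    have supp: "{j \<in> carrier G. f' j \<noteq> \<zero>\<^bsub>M\<^esub>} \<subseteq> F'"
    proof
      fix j assume j: "j \<in> {j \<in> carrier G. f' j \<noteq> \<zero>\<^bsub>M\<^esub>}"
      then have "inv\<^bsub>G\<^esub> g \<otimes>\<^bsub>G\<^esub> j \<in> F"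
        using g aR by (auto simp: f'_def F_def)
      moreover have "j = g \<otimes>\<^bsub>G\<^esub> (inv\<^bsub>G\<^esub> g \<otimes>\<^bsub>G\<^esub> j)"
        using g j by (simp add: G.m_assoc[symmetric])
      ultimately show "j \<in> F'"
        unfolding F'_def by blast
    qed
    have F': "finite F'" "F' \<subseteq> carrier G"
      using F g by (auto simp: F'_def)
    have f'_M: "f' \<in> F' \<rightarrow> carrier M"
      using f'_in gm_sub F' by blast
    have "x = finsum M (\<lambda>i. a \<odot>\<^bsub>M\<^esub> f i) F"
      unfolding m(2) F(3) using F aR f_M by (intro finsum_smult_ldistr) auto
    also have "\<dots> = finsum M (\<lambda>i. f' (g \<otimes>\<^bsub>G\<^esub> i)) F"
      using F f'_shift aR f_M by (intro M.finsum_cong') auto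
    also have "\<dots> = finsum M f' F'"
      unfolding F'_def using f'_M F g
      by (intro M.add.finprod_reindex[symmetric]) (auto simp: F'_def inj_on_def subset_iff)
    also have "\<dots> = finsum M f' {j \<in> carrier G. f' j \<noteq> \<zero>\<^bsub>M\<^esub>}"
      using F' f'_M supp by (intro M.add.finprod_mono_neutral_cong_right) auto
    finally have "components_of M (carrier G) (\<lambda>i. (\<odot>\<^bsub>M\<^esub>) a ` carrier M \<inter> gm i) f' x"
      using f'_in finite_subset[OF supp F'(1)]
      by (auto simp: components_of_def PiE_iff f'_def)
    then show "\<exists>f. components_of M (carrier G) (\<lambda>i. (\<odot>\<^bsub>M\<^esub>) a ` carrier M \<inter> gm i) f x"
      by blast
  qed
  with sub show ?thesis
    by (simp add: graded_submodule_def)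
qed

lemma ideal_smult_subset_iff:
  assumes M: "module R M" and P: "submodule P R M" and I: "I \<subseteq> carrier R"
  shows "ideal_smult I M \<subseteq> P \<longleftrightarrow> I \<subseteq> residual R M P"
proof
  interpret module R M by fact
  assume *: "ideal_smult I M \<subseteq> P"
  have "a \<odot>\<^bsub>M\<^esub> m \<in> ideal_smult I M" if "a \<in> I" "m \<in> carrier M" for a m
    unfolding ideal_smult_def using that by (blast intro: generate.incl)
  with * I show "I \<subseteq> residual R M P"
    by (auto simp: residual_def)
next
  interpret module R M by fact
  assume "I \<subseteq> residual R M P"
  then have "{a \<odot>\<^bsub>M\<^esub> m | a m. a \<in> I \<and> m \<in> carrier M} \<subseteq> P"
    by (auto simp: residual_def)
  then show "ideal_smult I M \<subseteq> P"
    unfolding ideal_smult_def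
    by (rule M.add.generate_subgroup_incl) (rule submodule.axioms(1)[OF P])
qed

lemma residual_Inter: "\<X> \<noteq> {} \<Longrightarrow> residual R M (\<Inter>\<X>) = \<Inter>(residual R M ` \<X>)"
  by (auto simp: residual_def)


section \<open>Topologies generated by a subbasis\<close>

lemma openin_topology_generated_by_nhd:
  assumes "openin (topology_generated_by \<B>) W" and "x \<in> W"
  obtains F where "finite F" "F \<noteq> {}" "F \<subseteq> \<B>" "x \<in> \<Inter>F" "\<Inter>F \<subseteq> W"
proof -
  have "generate_topology_on \<B> W"
    using assms(1) by (rule openin_topology_generated_by)
  then have "\<exists>F. finite F \<and> F \<noteq> {} \<and> F \<subseteq> \<B> \<and> x \<in> \<Inter>F \<and> \<Inter>F \<subseteq> W"
    using assms(2)
  proof (induction arbitrary: x rule: generate_topology_on.induct)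
    case (Int a b)
    then have x: "x \<in> a" "x \<in> b" by auto
    obtain F where F: "finite F" "F \<noteq> {}" "F \<subseteq> \<B>" "x \<in> \<Inter>F" "\<Inter>F \<subseteq> a"
      using Int.IH(1)[OF x(1)] by blast
    obtain F' where F': "finite F'" "F' \<subseteq> \<B>" "x \<in> \<Inter>F'" "\<Inter>F' \<subseteq> b"
      using Int.IH(2)[OF x(2)] by blast
    have "\<Inter>(F \<union> F') \<subseteq> a \<inter> b"
      using F F' by (simp add: Inter_Un_distrib le_infI1 le_infI2)
    then show ?case
      using F F' by (intro exI[of _ "F \<union> F'"]) auto
  next
    case (UN K)
    then obtain k where k: "k \<in> K" "x \<in> k" by blast
    obtain F where "finite F" "F \<noteq> {}" "F \<subseteq> \<B>" "x \<in> \<Inter>F" "\<Inter>F \<subseteq> k"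
      using UN.IH[OF k] by blast
    then show ?case
      using k(1) by (intro exI[of _ F]) blast
  next
    case (Basis s)
    then show ?case
      by (intro exI[of _ "{s}"]) auto
  qed simp
  then show thesis
    using that by (elim exE conjE)
qed

text \<open>If \<open>Y\<close> is an irreducible closed set, then it is the intersection of the complements of the
  subbasic open sets disjoint from it.\<close>

lemma irreducible_closed_subbase:
  assumes closed: "closedin (topology_generated_by \<B>) Y"
    and irr: "irreducible_subset (topology_generated_by \<B>) Y"
    and x: "x \<in> topspace (topology_generated_by \<B>) - Y"
  obtains B where "B \<in> \<B>" "x \<in> B" "B \<inter> Y = {}"
proof -
  let ?T = "topology_generated_by \<B>"
  have "openin ?T (topspace ?T - Y)"
    using closed by blast
  then obtain F where F: "finite F" "F \<noteq> {}" "F \<subseteq> \<B>" "x \<in> \<Inter>F" "\<Inter>F \<subseteq> topspace ?T - Y"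
    using x openin_topology_generated_by_nhd by metis
  have closed': "closedin ?T (topspace ?T - B)" if "B \<in> \<B>" for B
    using that topology_generated_by_Basis by blast
  have Y: "Y \<subseteq> topspace ?T" "Y \<noteq> {}"
    using irr by (auto simp: irreducible_subset_def)
  have covered: "\<exists>B\<in>H. Y \<subseteq> topspace ?T - B"
    if "finite H" "H \<subseteq> \<B>" "Y \<subseteq> (\<Union>B\<in>H. topspace ?T - B)" for H
    using that
  proof (induction H rule: finite_induct)
    case empty
    then show ?case using Y by simp
  next
    case (insert B H)
    have "closedin ?T (\<Union>B\<in>H. topspace ?T - B)"
      using insert.hyps insert.prems closed' by (intro closedin_Union) auto
    then have "Y \<subseteq> topspace ?T - B \<or> Y \<subseteq> (\<Union>B\<in>H. topspace ?T - B)"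
      using irr insert.prems closed'[of B] by (simp add: irreducible_subset_def)
    then show ?case
      using insert.IH insert.prems by blast
  qed
  have "Y \<subseteq> (\<Union>B\<in>F. topspace ?T - B)"
  proof
    fix y assume y: "y \<in> Y"
    then have "y \<notin> \<Inter>F" using F(5) by blast
    then show "y \<in> (\<Union>B\<in>F. topspace ?T - B)"
      using y Y(1) by blast
  qed
  from covered[OF F(1) F(3) this] obtain B where B: "B \<in> F" "Y \<subseteq> topspace ?T - B"
    by blast
  show thesis
  proof (rule that[of B])
    show "B \<in> \<B>" "x \<in> B" "B \<inter> Y = {}"
      using B F(3,4) by blast+
  qed
qed

lemma (in noetherian_ring) maximal_ideal_exists:
  assumes ne: "\<S> \<noteq> {}" and ideals: "\<And>I. I \<in> \<S> \<Longrightarrow> ideal I R"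
  obtains I where "I \<in> \<S>" "\<And>J. J \<in> \<S> \<Longrightarrow> I \<subseteq> J \<Longrightarrow> J = I"
proof -
  have "\<Union>C \<in> \<S>" if "C \<noteq> {}" "subset.chain \<S> C" for C
  proof -
    have "subset.chain {I. ideal I R} C"
      using that ideals by (auto simp: subset_chain_def)
    with that show ?thesis
      using ideal_chain_is_trivial[of C] by (auto simp: subset_chain_def)
  qed
  then have "\<exists>I\<in>\<S>. \<forall>J\<in>\<S>. I \<subseteq> J \<longrightarrow> J = I"
    by (rule subset_Zorn_nonempty[OF ne])
  then obtain I where I: "I \<in> \<S>" "\<forall>J\<in>\<S>. I \<subseteq> J \<longrightarrow> J = I"
    by blast
  show thesis
    by (rule that[OF I(1)]) (rule I(2)[rule_format])
qed

text \<open>The Zariski-type topology of a family of ideals \<open>\<rho> x\<close> of a Noetherian ring, indexed by the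
  points of \<open>X\<close>: every set of points is compact. Only a subbasis is described by ideals.\<close>

lemma (in noetherian_ring) compactin_subbase_of_ideals:
  assumes rho: "\<And>x. x \<in> X \<Longrightarrow> ideal (\<rho> x) R"
    and \<B>: "\<And>B. B \<in> \<B> \<Longrightarrow> \<exists>I. ideal I R \<and> B = X - {x \<in> X. I \<subseteq> \<rho> x}"
    and space: "topspace (topology_generated_by \<B>) = X" and S: "S \<subseteq> X"
  shows "compactin (topology_generated_by \<B>) S"
proof -
  let ?T = "topology_generated_by \<B>"
  define V where "V I = {x \<in> X. I \<subseteq> \<rho> x}" for I
  define bad where "bad = {I. ideal I R \<and> \<not> compactin ?T (S \<inter> V I)}"
  have "bad = {}"
  proof (rule ccontr)
    assume "bad \<noteq> {}"
    moreover have "ideal I R" if "I \<in> bad" for I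
      using that by (simp add: bad_def)
    ultimately obtain I where I: "I \<in> bad" and max: "\<And>J. J \<in> bad \<Longrightarrow> I \<subseteq> J \<Longrightarrow> J = I"
      using maximal_ideal_exists by metis
    have idI: "ideal I R" using I by (simp add: bad_def)
    \<comment> \<open>\<open>V I \<inter> V J\<close> is \<open>V\<close> of the ideal generated by \<open>I \<union> J\<close>, to which maximality of \<open>I\<close> applies.\<close>
    have smaller: "compactin ?T (S \<inter> V I \<inter> V J)" if J: "ideal J R" and VJ: "\<not> V I \<subseteq> V J" for J
    proof -
      let ?K = "Idl (I \<union> J)"
      have IJ: "I \<union> J \<subseteq> carrier R"
        using idI J by (simp add: additive_subgroup.a_subset ideal.axioms(1))
      have K: "ideal ?K R" "I \<union> J \<subseteq> ?K"
        using genideal_ideal[OF IJ] genideal_self[OF IJ] by blast+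
      have "?K \<subseteq> \<rho> x \<longleftrightarrow> I \<union> J \<subseteq> \<rho> x" if "x \<in> X" for x
        using K(2) genideal_minimal[OF rho[OF that]] by blast
      then have VK: "V ?K = V I \<inter> V J"
        by (auto simp: V_def)
      then have "?K \<noteq> I"
        using VJ by (metis Int_lower2)
      moreover have "I \<subseteq> ?K"
        using K(2) by simp
      ultimately have "?K \<notin> bad"
        using max by metis
      then show ?thesis
        using K VK by (simp add: bad_def Int_assoc)
    qed
    have "compactin ?T (S \<inter> V I)"
      unfolding compactin_def
    proof (intro conjI allI impI)
      show "S \<inter> V I \<subseteq> topspace ?T"
        using S space by blast
      fix \<U> assume \<U>: "Ball \<U> (openin ?T) \<and> S \<inter> V I \<subseteq> \<Union>\<U>"
      show "\<exists>\<F>. finite \<F> \<and> \<F> \<subseteq> \<U> \<and> S \<inter> V I \<subseteq> \<Union>\<F>"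
      proof (cases "S \<inter> V I = {}")
        case True
        then show ?thesis by (intro exI[of _ "{}"]) simp
      next
        case False
        then obtain x W where x: "x \<in> S" "x \<in> V I" "W \<in> \<U>" "x \<in> W"
          using \<U> by blast
        have "openin ?T W"
          using \<U> x(3) by blast
        then obtain F where F: "finite F" "F \<subseteq> \<B>" "x \<in> \<Inter>F" "\<Inter>F \<subseteq> W"
          using x(4) by (rule openin_topology_generated_by_nhd)
        \<comment> \<open>The points outside the neighbourhood \<open>\<Inter>F\<close> of \<open>x\<close> miss some \<open>B \<in> F\<close>; as \<open>x \<in> B\<close>, the
            ideal of \<open>B\<close> is not contained in \<open>\<rho> x\<close>.\<close>
        have comp: "compactin ?T (S \<inter> V I - B)" if B: "B \<in> F" for B
        proof -
          obtain J where J: "ideal J R" "B = X - V J"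
            using \<B>[OF subsetD[OF F(2) B]] unfolding V_def by (elim exE conjE)
          have "x \<in> B"
            using F(3) B by blast
          then have "\<not> V I \<subseteq> V J"
            using x(2) J(2) by blast
          moreover have "S \<inter> V I - B = S \<inter> V I \<inter> V J"
            using J S by (auto simp: V_def)
          ultimately show ?thesis
            using smaller J by simp
        qed
        have "compactin ?T (\<Union>B\<in>F. S \<inter> V I - B)"
          using F(1) comp by (intro compactin_Union) auto
        moreover have "(\<Union>B\<in>F. S \<inter> V I - B) \<subseteq> \<Union>\<U>"
          using \<U> by blast
        ultimately obtain \<F> where
          \<F>: "finite \<F>" "\<F> \<subseteq> \<U>" "(\<Union>B\<in>F. S \<inter> V I - B) \<subseteq> \<Union>\<F>"
          using compactinD[of ?T "\<Union>B\<in>F. S \<inter> V I - B" \<U>] \<U> by blast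
        have "S \<inter> V I \<subseteq> \<Union>(insert W \<F>)"
        proof
          fix y assume y: "y \<in> S \<inter> V I"
          show "y \<in> \<Union>(insert W \<F>)"
          proof (cases "y \<in> \<Inter>F")
            case True
            then show ?thesis using F(4) by blast
          next
            case False
            then have "y \<in> (\<Union>B\<in>F. S \<inter> V I - B)" using y by blast
            then show ?thesis using \<F>(3) by blast
          qed
        qed
        moreover have "finite (insert W \<F>)" "insert W \<F> \<subseteq> \<U>"
          using \<F>(1,2) x(3) by auto
        ultimately show ?thesis by blast
      qed
    qed
    with I show False by (simp add: bad_def)
  qed
  then have "compactin ?T (S \<inter> V {\<zero>})"
    using zeroideal unfolding bad_def by blast
  moreover have "S \<inter> V {\<zero>} = S"
    using S rho by (auto simp: V_def additive_subgroup.zero_closed ideal.axioms(1))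
  ultimately show ?thesis by simp
qed


section \<open>The Zariski topology\<close>

lemma pseudo_weakly_spectrum_residual:
  assumes "P \<in> pseudo_weakly_spectrum G R gr M gm"
  shows "submodule P R M" "graded_submodule G R M gm P"
    "graded_ideal G R gr (residual R M P)" "ideal (residual R M P) R"
    "residual R M P \<noteq> carrier R"
  using assms
  by (auto simp: pseudo_weakly_spectrum_def graded_submodule_def graded_weakly_prime_def
      graded_ideal_def)

text \<open>The whole spectrum is itself subbasic open, because \<open>\<chi>(M)\<close> is empty: a point of the spectrum has
  a proper residual.\<close>

lemma topspace_zariski_topology:
  assumes M: "graded_module G R gr M gm"
  shows "topspace (zariski_topology G R gr M gm) = pseudo_weakly_spectrum G R gr M gm"
proof -
  interpret module R M
    using M by (simp add: graded_module_def)
  have gm: "internal_direct_sum M (carrier G) gm (carrier M)"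
    using M by (simp add: graded_module_def)
  then have gm_sub: "gm i \<subseteq> carrier M" if "i \<in> carrier G" for i
    using that by (simp add: internal_direct_sum_def)
  have "internal_direct_sum M (carrier G) (\<lambda>i. carrier M \<inter> gm i) (carrier M)"
  proof (rule internal_direct_sum_subgroupI[OF M.abelian_group_axioms gm])
    show "additive_subgroup (carrier M) M"
      using gm by (simp add: internal_direct_sum_def)
    fix x assume "x \<in> carrier M"
    then obtain f where "components_of M (carrier G) gm f x"
      using gm by (auto simp: internal_direct_sum_components_of)
    then have "components_of M (carrier G) (\<lambda>i. carrier M \<inter> gm i) f x"
      by (rule components_of_mono) (simp add: gm_sub)
    then show "\<exists>f. components_of M (carrier G) (\<lambda>i. carrier M \<inter> gm i) f x"
      by blast
  qed
  then have "graded_submodule G R M gm (carrier M)"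
    by (simp add: graded_submodule_def carrier_is_submodule)
  moreover have "zariski_closed G R gr M gm (carrier M) = {}"
  proof -
    have "residual R M P = carrier R" if "carrier M \<subseteq> P" for P
      using that by (auto simp: residual_def)
    then show ?thesis
      using pseudo_weakly_spectrum_residual(5)[of _ G R gr M gm]
      unfolding zariski_closed_def by blast
  qed
  ultimately have "pseudo_weakly_spectrum G R gr M gm
      \<in> {pseudo_weakly_spectrum G R gr M gm - zariski_closed G R gr M gm N | N.
          graded_submodule G R M gm N}" (is "?U \<in> ?B")
    by (metis (mono_tags, lifting) Diff_empty mem_Collect_eq)
  then show ?thesis
    unfolding zariski_topology_def topology_generated_by_topspace by (intro equalityI Union_upper) auto
qed

lemma closedin_zariski_closed:
  assumes M: "graded_module G R gr M gm" and N: "graded_submodule G R M gm N"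
  shows "closedin (zariski_topology G R gr M gm) (zariski_closed G R gr M gm N)"
proof -
  have "openin (zariski_topology G R gr M gm)
      (pseudo_weakly_spectrum G R gr M gm - zariski_closed G R gr M gm N)"
    unfolding zariski_topology_def using N by (intro topology_generated_by_Basis) blast
  then show ?thesis
    by (auto simp: closedin_def topspace_zariski_topology[OF M] zariski_closed_def)
qed

lemma closure_of_zariski_point:
  assumes M: "graded_module G R gr M gm" and Q: "Q \<in> pseudo_weakly_spectrum G R gr M gm"
  shows "zariski_topology G R gr M gm closure_of {Q} = zariski_closed G R gr M gm Q"
proof
  show "zariski_topology G R gr M gm closure_of {Q} \<subseteq> zariski_closed G R gr M gm Q"
    using closedin_zariski_closed[OF M pseudo_weakly_spectrum_residual(2)[OF Q]] Q
    by (intro closure_of_minimal) (auto simp: zariski_closed_def)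
  show "zariski_closed G R gr M gm Q \<subseteq> zariski_topology G R gr M gm closure_of {Q}"
  proof
    fix P assume P: "P \<in> zariski_closed G R gr M gm Q"
    have "Q \<in> W" if W: "openin (zariski_topology G R gr M gm) W" "P \<in> W" for W
    proof -
      obtain F where F: "P \<in> \<Inter>F" "\<Inter>F \<subseteq> W"
        "F \<subseteq> {pseudo_weakly_spectrum G R gr M gm - zariski_closed G R gr M gm N | N.
          graded_submodule G R M gm N}"
        using W unfolding zariski_topology_def by (rule openin_topology_generated_by_nhd)
      have "Q \<in> B" if B: "B \<in> F" for B
      proof -
        obtain N where "B = pseudo_weakly_spectrum G R gr M gm - zariski_closed G R gr M gm N"
          using subsetD[OF F(3) B] by blast
        moreover have "P \<in> B"
          using F(1) B by blast
        ultimately show ?thesis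
          using P Q by (auto simp: zariski_closed_def)
      qed
      then show ?thesis
        using F(2) by blast
    qed
    moreover have "P \<in> topspace (zariski_topology G R gr M gm)"
      using P by (simp add: topspace_zariski_topology[OF M] zariski_closed_def)
    ultimately show "P \<in> zariski_topology G R gr M gm closure_of {Q}"
      by (auto simp: in_closure_of)
  qed
qed

lemma t0_space_zariski_topology:
  assumes M: "graded_module G R gr M gm"
  shows "t0_space (zariski_topology G R gr M gm)"
proof -
  have "P = Q"
    if "P \<in> pseudo_weakly_spectrum G R gr M gm" "Q \<in> pseudo_weakly_spectrum G R gr M gm"
      "zariski_closed G R gr M gm P = zariski_closed G R gr M gm Q" for P Q
    using that by (auto simp: zariski_closed_def)
  then show ?thesis
    by (auto simp: t0_space_closure_of_sing topspace_zariski_topology[OF M]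
        closure_of_zariski_point[OF M])
qed

text \<open>Every \<open>I\<close> with \<open>\<chi>(P) = \<chi>(IM)\<close> satisfies \<open>\<chi>(P) = V(I)\<close>, so the subbasis comes from ideals of
  the Noetherian ring \<open>R\<close>.\<close>

lemma compactin_zariski_topology:
  assumes M: "graded_module G R gr M gm" and R: "noetherian_ring R"
    and ex: "\<And>P. graded_submodule G R M gm P \<Longrightarrow>
           \<exists>I. graded_ideal G R gr I \<and>
             zariski_closed G R gr M gm P = zariski_closed G R gr M gm (ideal_smult I M)"
    and S: "S \<subseteq> pseudo_weakly_spectrum G R gr M gm"
  shows "compactin (zariski_topology G R gr M gm) S"
proof -
  let ?U = "pseudo_weakly_spectrum G R gr M gm"
  have mod: "module R M"
    using M by (simp add: graded_module_def)
  have V: "\<exists>I. ideal I R \<and> zariski_closed G R gr M gm N = {P \<in> ?U. I \<subseteq> residual R M P}"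
    if N: "graded_submodule G R M gm N" for N
  proof -
    obtain I where I: "ideal I R"
        "zariski_closed G R gr M gm N = zariski_closed G R gr M gm (ideal_smult I M)"
      using ex[OF N] by (auto simp: graded_ideal_def)
    have "I \<subseteq> carrier R"
      using I by (simp add: additive_subgroup.a_subset ideal.axioms(1))
    then have "ideal_smult I M \<subseteq> P \<longleftrightarrow> I \<subseteq> residual R M P" if "P \<in> ?U" for P
      using ideal_smult_subset_iff[OF mod pseudo_weakly_spectrum_residual(1)[OF that]] by simp
    then have "zariski_closed G R gr M gm (ideal_smult I M) = {P \<in> ?U. I \<subseteq> residual R M P}"
      unfolding zariski_closed_def by blast
    with I show ?thesis by auto
  qed
  have subbase: "\<exists>I. ideal I R \<and> B = ?U - {P \<in> ?U. I \<subseteq> residual R M P}"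
    if "B \<in> {?U - zariski_closed G R gr M gm N | N. graded_submodule G R M gm N}" for B
  proof -
    from that obtain N where N: "graded_submodule G R M gm N"
      "B = ?U - zariski_closed G R gr M gm N"
      by blast
    obtain I where "ideal I R" "zariski_closed G R gr M gm N = {P \<in> ?U. I \<subseteq> residual R M P}"
      using V[OF N(1)] by blast
    with N(2) show ?thesis
      by (intro exI[of _ I]) simp
  qed
  show ?thesis
    unfolding zariski_topology_def
  proof (rule noetherian_ring.compactin_subbase_of_ideals[OF R])
    show "ideal (residual R M P) R" if "P \<in> ?U" for P
      using that by (rule pseudo_weakly_spectrum_residual(4))
  qed (use subbase topspace_zariski_topology[OF M] S in \<open>simp_all add: zariski_topology_def\<close>)
qed

text \<open>No closedness is needed: irreducibility of \<open>Y\<close> is applied to the closed sets \<open>\<chi>(aM)\<close> and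
  \<open>\<chi>(bM)\<close> only.\<close>

lemma irreducible_Inter_in_spectrum:
  assumes M: "graded_module G R gr M gm"
    and irr: "irreducible_subset (zariski_topology G R gr M gm) Y"
  shows "\<Inter>Y \<in> pseudo_weakly_spectrum G R gr M gm"
proof -
  let ?U = "pseudo_weakly_spectrum G R gr M gm"
  have R: "graded_ring G R gr"
    using M by (simp add: graded_module_def)
  have Y: "Y \<subseteq> ?U" "Y \<noteq> {}"
    using irr by (auto simp: irreducible_subset_def topspace_zariski_topology[OF M])
  have res: "residual R M (\<Inter>Y) = \<Inter>(residual R M ` Y)"
    using Y by (simp add: residual_Inter)
  have "graded_ideal G R gr (residual R M (\<Inter>Y))"
    unfolding res using Y pseudo_weakly_spectrum_residual(3)
    by (intro graded_ideal_Inter[OF R]) blast+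
  moreover have "residual R M (\<Inter>Y) \<noteq> carrier R"
  proof
    assume *: "residual R M (\<Inter>Y) = carrier R"
    obtain P where P: "P \<in> Y" using Y by blast
    then have "residual R M P = carrier R"
      using * res by (auto simp: residual_def)
    then show False
      using P Y pseudo_weakly_spectrum_residual(5) by blast
  qed
  moreover have "a \<in> residual R M (\<Inter>Y) \<or> b \<in> residual R M (\<Inter>Y)"
    if a: "a \<in> homogeneous G gr" and b: "b \<in> homogeneous G gr"
      and ab: "a \<otimes>\<^bsub>R\<^esub> b \<noteq> \<zero>\<^bsub>R\<^esub>" "a \<otimes>\<^bsub>R\<^esub> b \<in> residual R M (\<Inter>Y)" for a b
  proof -
    let ?mult = "\<lambda>c. (\<odot>\<^bsub>M\<^esub>) c ` carrier M"
    have chi: "zariski_closed G R gr M gm (?mult c) = {P \<in> ?U. c \<in> residual R M P}"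
      if c: "c \<in> homogeneous G gr" for c
    proof -
      have "c \<in> carrier R"
        using c R by (auto simp: homogeneous_def graded_ring_def internal_direct_sum_def)
      then show ?thesis
        by (auto simp: zariski_closed_def residual_def)
    qed
    have "Y \<subseteq> zariski_closed G R gr M gm (?mult a) \<union> zariski_closed G R gr M gm (?mult b)"
    proof
      fix P assume P: "P \<in> Y"
      then have "a \<otimes>\<^bsub>R\<^esub> b \<in> residual R M P" "graded_weakly_prime G R gr (residual R M P)"
        using ab(2) res Y by (auto simp: pseudo_weakly_spectrum_def)
      then have "a \<in> residual R M P \<or> b \<in> residual R M P"
        using a b ab(1) by (auto simp: graded_weakly_prime_def)
      then show "P \<in> zariski_closed G R gr M gm (?mult a) \<union> zariski_closed G R gr M gm (?mult b)"
        using P Y a b by (auto simp: chi)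
    qed
    then have "Y \<subseteq> zariski_closed G R gr M gm (?mult a) \<or> Y \<subseteq> zariski_closed G R gr M gm (?mult b)"
      using irr closedin_zariski_closed[OF M graded_submodule_smult_image[OF M]] a b
      by (simp add: irreducible_subset_def)
    then show ?thesis
      using a b by (auto simp: chi res)
  qed
  ultimately have "graded_weakly_prime G R gr (residual R M (\<Inter>Y))"
    by (simp add: graded_weakly_prime_def)
  moreover have "graded_submodule G R M gm (\<Inter>Y)"
    using Y pseudo_weakly_spectrum_residual(2) by (intro graded_submodule_Inter[OF M]) blast+
  ultimately show ?thesis
    by (simp add: pseudo_weakly_spectrum_def)
qed

lemma irreducible_closed_has_generic_point:
  assumes M: "graded_module G R gr M gm"
    and closed: "closedin (zariski_topology G R gr M gm) Y"
    and irr: "irreducible_subset (zariski_topology G R gr M gm) Y"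
  shows "\<Inter>Y \<in> Y" "zariski_topology G R gr M gm closure_of {\<Inter>Y} = Y"
proof -
  let ?U = "pseudo_weakly_spectrum G R gr M gm"
  have Q: "\<Inter>Y \<in> ?U"
    using M irr by (rule irreducible_Inter_in_spectrum)
  have Y: "Y \<subseteq> ?U"
    using irr by (auto simp: irreducible_subset_def topspace_zariski_topology[OF M])
  show QY: "\<Inter>Y \<in> Y"
  proof (rule ccontr)
    assume "\<Inter>Y \<notin> Y"
    then have "\<Inter>Y \<in> topspace (zariski_topology G R gr M gm) - Y"
      using Q by (simp add: topspace_zariski_topology[OF M])
    then show False
      unfolding zariski_topology_def
    proof (rule irreducible_closed_subbase[OF closed[unfolded zariski_topology_def]
          irr[unfolded zariski_topology_def]])
      fix B assume B: "\<Inter>Y \<in> B" "B \<inter> Y = {}"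
        "B \<in> {?U - zariski_closed G R gr M gm N | N. graded_submodule G R M gm N}"
      then obtain N where N: "B = ?U - zariski_closed G R gr M gm N"
        by blast
      have "N \<subseteq> P" if "P \<in> Y" for P
        using B(2) N Y that unfolding zariski_closed_def by blast
      then have "\<Inter>Y \<in> zariski_closed G R gr M gm N"
        using Q by (auto simp: zariski_closed_def)
      then show False
        using B(1) N by simp
    qed
  qed
  have "zariski_closed G R gr M gm (\<Inter>Y) \<supseteq> Y"
    using Y by (auto simp: zariski_closed_def)
  moreover have "zariski_topology G R gr M gm closure_of {\<Inter>Y} \<subseteq> Y"
    using QY closed by (intro closure_of_minimal) auto
  ultimately show "zariski_topology G R gr M gm closure_of {\<Inter>Y} = Y"
    using closure_of_zariski_point[OF M Q] by blast
qed

theorem theorem3p14: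
  fixes G :: "('g, 'k) monoid_scheme"
    and R :: "('a, 'c) ring_scheme" and gr :: "'g \<Rightarrow> 'a set"
    and M :: "('a, 'b, 'd) module_scheme" and gm :: "'g \<Rightarrow> 'b set"
  assumes "graded_ring G R gr"
    and "graded_module G R gr M gm"
    and "graded_weakly_topological G R gr M gm"
    and "noetherian_ring R"
    and "\<And>P. graded_submodule G R M gm P \<Longrightarrow>
           \<exists>I. graded_ideal G R gr I \<and>
             zariski_closed G R gr M gm P = zariski_closed G R gr M gm (ideal_smult I M)"
  shows "graded_weakly_spectral_space (zariski_topology G R gr M gm)"
proof -
  let ?T = "zariski_topology G R gr M gm"
  have compact: "compactin ?T S" if "S \<subseteq> topspace ?T" for S
    using compactin_zariski_topology[OF assms(2,4,5)] that topspace_zariski_topology[OF assms(2)]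
    by auto
  have "compactin ?T (U \<inter> V)" if "openin ?T U" for U V
    using openin_subset[OF that] by (intro compact) blast
  moreover have "\<exists>x\<in>Y. ?T closure_of {x} = Y" if "closedin ?T Y" "irreducible_subset ?T Y" for Y
    using irreducible_closed_has_generic_point[OF assms(2) that] by blast
  ultimately show ?thesis
    using t0_space_zariski_topology[OF assms(2)] compact
    by (simp add: graded_weakly_spectral_space_def compact_space_def)
qed

end
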